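(* Problem $P(\overline{g}_1,f_{12},h)$ satisfies: (a) If $\min\{\overline{g}_1,f_{12}\}<\max_{t\in[T]}\left(\frac{\sum_{\tau=1}^td_2(\tau)}{t}\right)$, then $P(\overline{g}_1,f_{12},h)$ is infeasible for all $h\ge 0$. (b) Suppose $\min\{\overline{g}_1,f_{12}\}\ge\max_{t\in[T]}\left(\frac{\sum_{\tau=1}^td_2(\tau)}{t}\right)$. Then $P(\overline{g}_1,f_{12},h)$ is feasible if and only if $h\ge h_{\min}$, and $p_*(\overline{g}_1,f_{12},h)$ is convex and non-increasing in $h$ (for $h\ge h_{\min}$), where $$h_{\min}=\max_{0\le t_1\le t_2\le T}\left[\sum_{\tau=t_1+1}^{t_2}\left(d_2(\tau)-\min\{\overline{g}_1,f_{12}\}\right)\right]^+.$$ Furthermore, $p_*(\overline{g}_1,f_{12},h)$ is constant for all $h\ge h_{sat}$, where $h_{sat}=\max_{1\le m\le M}u_m$ and $$u_m:=\max_{\tau_{m-1}+1\le t\le\tau_m}\left[\left(\sum_{\tau=\tau_{m-1}+1}^{\tau_m}d_2(\tau)\right)\frac{t-\tau_{m-1}}{\tau_m-\tau_{m-1}}-\left(\sum_{\tau=\tau_{m-1}+1}^{t}d_2(\tau)\right)\right].$$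
   Context: Single generator single load network: a generator at bus 1 (no demand) with generation capacity $\overline{g}_1\ge0$ is connected by one line of capacity $f_{12}\ge 0$ to a load at bus 2 (no generation) with given demand profile $d_2(t)\ge 0$, $t\in[T]=\{1,\dots,T\}$. The generation cost $c_1:[0,\infty)\to[0,\infty)$ is nondecreasing and strictly convex. Storage is perfectly efficient and ramp constraints are ignored (charging/discharging efficiencies and ramp constants all equal to 1). Problem $P(\overline{g}_1,f_{12},h)$, with storage budget $h\ge0$: minimize $\sum_{t=1}^Tc_1(g_1(t))$ over real $g_1(t)$, $r_1(t)$, $r_2(t)$, $b_1,b_2$ ($t\in[T]$), where $r_k(t)$ is the net power flowing into the storage at bus $k$ (charging minus discharging), subject to, for $t\in[T]$ and $k=1,2$: $0\le g_1(t)\le\overline{g}_1$; the power sent from bus 1 to bus 2 satisfies $p_{12}(t)=g_1(t)-r_1(t)=d_2(t)+r_2(t)$ and $|p_{12}(t)|\le f_{12}$; $0\le s_k(t)\le b_k$ where $s_k(t)=\sum_{\tau=1}^tr_k(\tau)$; $s_k(T)=0$; $b_1,b_2\ge 0$ and $b_1+b_2\le h$. Its optimal value is $p_*(\overline{g}_1,f_{12},h)$. Notation: $[x]^+=\max(x,0)$. The sequence $\{\tau_m\}_{m=0}^M$ is defined by $\tau_0=0$ and, iteratively, $$\tau_m=\operatorname*{arg\,max}_{\tau_{m-1}+1\le t\le T}\left(\frac{\sum_{\tau=\tau_{m-1}+1}^{t}d_2(\tau)}{t-\tau_{m-1}}\right),\qquad 1\le m\le M,$$ where $M$ is the smallest integer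 with $\tau_M=T$ (if the maximizer is not unique, $\tau_m$ is any maximizer). *)

theory Defs
  imports "HOL-Analysis.Analysis"
begin

definition strictly_convex_on :: "real set \<Rightarrow> (real \<Rightarrow> real) \<Rightarrow> bool" where
  "strictly_convex_on S f \<longleftrightarrow> convex S \<and>
     (\<forall>x\<in>S. \<forall>y\<in>S. \<forall>u. x \<noteq> y \<longrightarrow> 0 < u \<longrightarrow> u < 1 \<longrightarrow>
        f ((1 - u) * x + u * y) < (1 - u) * f x + u * f y)"

text \<open>The storage is empty at time 0; \<open>r \<tau>\<close> is the net charging in period \<open>\<tau>\<close>.\<close>

definition storage_level :: "(nat \<Rightarrow> real) \<Rightarrow> nat \<Rightarrow> real" where
  "storage_level r t = (\<Sum>\<tau> = 1..t. r \<tau>)"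

text \<open>In the arguments \<open>r\<close> and \<open>b\<close> the first index is the bus, 1 or 2. The profiles \<open>d2\<close>, \<open>g1\<close>, \<open>r k\<close>
  are only meaningful on the periods \<open>{1..T}\<close>, and their values elsewhere play no role.\<close>

definition feasible_point ::
  "nat \<Rightarrow> (nat \<Rightarrow> real) \<Rightarrow> real \<Rightarrow> real \<Rightarrow> real \<Rightarrow>
   (nat \<Rightarrow> real) \<Rightarrow> (nat \<Rightarrow> nat \<Rightarrow> real) \<Rightarrow> (nat \<Rightarrow> real) \<Rightarrow> bool" where
  "feasible_point T d2 gmax f12 h g1 r b \<longleftrightarrow>
     (\<forall>t\<in>{1..T}.
        0 \<le> g1 t \<and> g1 t \<le> gmax \<and>
        g1 t - r 1 t = d2 t + r 2 t \<and> \<bar>g1 t - r 1 t\<bar> \<le> f12 \<and>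
        (\<forall>k\<in>{1, 2}. 0 \<le> storage_level (r k) t \<and> storage_level (r k) t \<le> b k)) \<and>
     (\<forall>k\<in>{1, 2}. storage_level (r k) T = 0 \<and> 0 \<le> b k) \<and>
     b 1 + b 2 \<le> h"

definition feasible :: "nat \<Rightarrow> (nat \<Rightarrow> real) \<Rightarrow> real \<Rightarrow> real \<Rightarrow> real \<Rightarrow> bool" where
  "feasible T d2 gmax f12 h \<longleftrightarrow> (\<exists>g1 r b. feasible_point T d2 gmax f12 h g1 r b)"

text \<open>The value is meaningful only when the problem is feasible: the real infimum of the
  empty set is unspecified.\<close>

definition opt_value ::
  "nat \<Rightarrow> (nat \<Rightarrow> real) \<Rightarrow> (real \<Rightarrow> real) \<Rightarrow> real \<Rightarrow> real \<Rightarrow> real \<Rightarrow> real" where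
  "opt_value T d2 c1 gmax f12 h =
     Inf {(\<Sum>t = 1..T. c1 (g1 t)) | g1 r b. feasible_point T d2 gmax f12 h g1 r b}"

definition max_avg_demand :: "nat \<Rightarrow> (nat \<Rightarrow> real) \<Rightarrow> real" where
  "max_avg_demand T d2 = (MAX t\<in>{1..T}. (\<Sum>\<tau> = 1..t. d2 \<tau>) / real t)"

definition h_min :: "nat \<Rightarrow> (nat \<Rightarrow> real) \<Rightarrow> real \<Rightarrow> real \<Rightarrow> real" where
  "h_min T d2 gmax f12 =
     Max {max (\<Sum>\<tau> = t1 + 1..t2. (d2 \<tau> - min gmax f12)) 0 | t1 t2. t1 \<le> t2 \<and> t2 \<le> T}"

text \<open>A relation rather than a function, since maximizers need not be unique.\<close>

definition tau_sequence :: "nat \<Rightarrow> (nat \<Rightarrow> real) \<Rightarrow> (nat \<Rightarrow> nat) \<Rightarrow> nat \<Rightarrow> bool" where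
  "tau_sequence T d2 tau M \<longleftrightarrow>
     tau 0 = 0 \<and>
     (\<forall>m\<in>{1..M}. is_arg_max
        (\<lambda>t. (\<Sum>\<tau> = tau (m-1) + 1..t. d2 \<tau>) / (real t - real (tau (m-1))))
        (\<lambda>t. tau (m-1) + 1 \<le> t \<and> t \<le> T) (tau m)) \<and>
     tau M = T \<and> (\<forall>m<M. tau m \<noteq> T)"

definition u_seg :: "(nat \<Rightarrow> real) \<Rightarrow> (nat \<Rightarrow> nat) \<Rightarrow> nat \<Rightarrow> real" where
  "u_seg d2 tau m =
     (MAX t\<in>{tau (m-1) + 1..tau m}.
        (\<Sum>\<tau> = tau (m-1) + 1..tau m. d2 \<tau>)
          * ((real t - real (tau (m-1))) / (real (tau m) - real (tau (m-1))))
        - (\<Sum>\<tau> = tau (m-1) + 1..t. d2 \<tau>))"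

definition h_sat :: "(nat \<Rightarrow> real) \<Rightarrow> (nat \<Rightarrow> nat) \<Rightarrow> nat \<Rightarrow> real" where
  "h_sat d2 tau M = (MAX m\<in>{1..M}. u_seg d2 tau m)"

lemma tau_sequence_exists: "\<exists>tau M. tau_sequence T d2 tau M"
proof -
  define F where "F x t = (\<Sum>\<tau> = x + 1..t. d2 \<tau>) / (real t - real x)" for x t :: nat
  have ex: "\<exists>y. is_arg_max (F x) (\<lambda>t. x + 1 \<le> t \<and> t \<le> T) y" if "x < T" for x
  proof -
    have "Max (F x ` {x+1..T}) \<in> F x ` {x+1..T}"
      by (rule Max_in) (use that in auto)
    then obtain y where y: "y \<in> {x+1..T}" "Max (F x ` {x+1..T}) = F x y" by (rule imageE)
    then have "F x z \<le> F x y" if "z \<in> {x+1..T}" for z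
      using that by (metis Max_ge finite_atLeastAtMost finite_imageI imageI)
    then show ?thesis
      unfolding is_arg_max_def using y(1) by (intro exI[of _ y]) (auto simp: not_less)
  qed
  define nxt where "nxt x = (SOME y. is_arg_max (F x) (\<lambda>t. x + 1 \<le> t \<and> t \<le> T) y)" for x
  have nxt: "is_arg_max (F x) (\<lambda>t. x + 1 \<le> t \<and> t \<le> T) (nxt x)" if "x < T" for x
    unfolding nxt_def using someI_ex[OF ex[OF that]] .
  define tau where "tau = rec_nat 0 (\<lambda>_ x. if x < T then nxt x else T)"
  have tau0: "tau 0 = 0" and tauS: "tau (Suc m) = (if tau m < T then nxt (tau m) else T)" for m
    by (simp_all add: tau_def)
  have le: "tau m \<le> T" for m
    by (cases m) (use nxt in \<open>auto simp: tau0 tauS is_arg_max_def\<close>)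
  have ge: "min m T \<le> tau m" for m
  proof (induction m)
    case (Suc m)
    then show ?case
      using nxt[of "tau m"] by (auto simp: tauS is_arg_max_def)
  qed simp
  define M where "M = (LEAST m. tau m = T)"
  have "tau T = T" using ge[of T] le[of T] by simp
  then have M: "tau M = T" unfolding M_def by (rule LeastI)
  have less: "tau m \<noteq> T" if "m < M" for m
    using not_less_Least that unfolding M_def by blast
  have "is_arg_max (F (tau (m-1))) (\<lambda>t. tau (m-1) + 1 \<le> t \<and> t \<le> T) (tau m)"
    if m: "m \<in> {1..M}" for m
  proof -
    obtain n where n: "m = Suc n" "n < M" using m by (cases m) auto
    with less[of n] le[of n] have "tau n < T" by simp
    then show ?thesis using nxt[of "tau n"] n by (simp add: tauS)
  qed
  then show ?thesis
    using tau0 M less unfolding tau_sequence_def F_def by blast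
qed

end

theory Submission
  imports Defs
begin

text \<open>Summing the balance equations, a generation profile is feasible only if cumulative generation
  dominates cumulative demand, with equality at \<open>T\<close>; conversely, storage at bus 2 alone is
  enough, since only the minimum of the two capacities matters. Convexity and monotonicity of the
  optimal value come from the joint convexity of the constraints in the variables and the budget.
  The points \<open>tau m\<close> are the breakpoints of the least concave majorant of cumulative demand. Its
  slopes, the averages of the demand over the segments, decrease, and they form the
  cheapest profile for any convex cost, by the subgradient inequality and Abel summation. Storage
  \<open>h_sat\<close> suffices to realise it.\<close>

section \<open>Segment sums and subgradients of the cost\<close>

lemma sum_segment:
  fixes f :: "nat \<Rightarrow> real"
  assumes "s \<le> t"
  shows "(\<Sum>\<tau> = s + 1..t. f \<tau>) = (\<Sum>\<tau> = 1..t. f \<tau>) - (\<Sum>\<tau> = 1..s. f \<tau>)"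
proof -
  have "(\<Sum>\<tau> = 1..t. f \<tau>) = (\<Sum>\<tau> = 1..s. f \<tau>) + (\<Sum>\<tau> = s + 1..t. f \<tau>)"
    using sum.ub_add_nat[of 1 s f "t - s"] assms by simp
  then show ?thesis by simp
qed

lemma strictly_convex_on_imp_convex_on:
  assumes "strictly_convex_on S f"
  shows "convex_on S f"
proof (rule convex_onI)
  fix t x y :: real assume "0 < t" "t < 1" "x \<in> S" "y \<in> S"
  then have "f ((1 - t) * x + t * y) < (1 - t) * f x + t * f y" if "x \<noteq> y"
    using assms that unfolding strictly_convex_on_def by blast
  then show "f ((1 - t) *\<^sub>R x + t *\<^sub>R y) \<le> (1 - t) * f x + t * f y"
    by (cases "x = y") (simp_all add: algebra_simps)
qed (use assms in \<open>simp add: strictly_convex_on_def\<close>)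

text \<open>Monotonicity provides the subgradient \<open>0\<close> at the boundary point \<open>0\<close>, where convexity alone
  would not.\<close>

lemma mono_convex_subgradient:
  fixes c :: "real \<Rightarrow> real"
  assumes "mono_on {0..} c" "convex_on {0..} c"
  obtains q where "\<And>x y. 0 \<le> x \<Longrightarrow> 0 \<le> y \<Longrightarrow> c x + q x * (y - x) \<le> c y"
    and "\<And>x y. 0 \<le> x \<Longrightarrow> x \<le> y \<Longrightarrow> q x \<le> q y"
proof -
  have "\<exists>k. \<forall>y\<ge>0. c x + k * (y - x) \<le> c y" if "0 \<le> x" for x
  proof (cases "x = 0")
    case True
    then show ?thesis using assms(1) by (intro exI[of _ 0]) (auto simp: monotone_on_def)
  next
    case False
    then have "x \<in> interior {0..}" using that by simp
    then show ?thesis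
      using convex_le_Inf_differential[OF assms(2)]
      by (metis atLeast_iff)
  qed
  then obtain q where q: "\<And>x y. 0 \<le> x \<Longrightarrow> 0 \<le> y \<Longrightarrow> c x + q x * (y - x) \<le> c y"
    by metis
  have "q x \<le> q y" if "0 \<le> x" "x \<le> y" for x y
  proof (cases "x = y")
    case False
    \<comment> \<open>Add the subgradient inequality at \<open>x\<close> evaluated in
      \<open>y\<close> to the one at \<open>y\<close> evaluated in \<open>x\<close>.\<close>
    have "0 \<le> (q y - q x) * (y - x)"
      using q[of x y] q[of y x] that by (simp add: algebra_simps)
    then show ?thesis using False that by (simp add: zero_le_mult_iff)
  qed simp
  with q that show ?thesis by blast
qed

section \<open>Necessary conditions for feasibility\<close>

text \<open>Sum the bus 2 balance over time. Two forms are kept because the two capacities act on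
  different inflows: the line limits what enters bus 2, the generator what enters the whole
  network.\<close>

lemma feasible_point_levels:
  assumes "feasible_point T d2 gmax f12 h g1 r b" "t \<le> T"
  shows "storage_level (r 2) t = (\<Sum>\<tau> = 1..t. g1 \<tau> - r 1 \<tau>) - (\<Sum>\<tau> = 1..t. d2 \<tau>)"
    and "storage_level (r 1) t + storage_level (r 2) t
           = (\<Sum>\<tau> = 1..t. g1 \<tau>) - (\<Sum>\<tau> = 1..t. d2 \<tau>)"
proof -
  have "r 2 \<tau> = g1 \<tau> - r 1 \<tau> - d2 \<tau>" if "\<tau> \<in> {1..t}" for \<tau>
    using assms that unfolding feasible_point_def by force
  then have "storage_level (r 2) t = (\<Sum>\<tau> = 1..t. g1 \<tau> - r 1 \<tau> - d2 \<tau>)"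
    unfolding storage_level_def by (intro sum.cong) auto
  then show "storage_level (r 2) t = (\<Sum>\<tau> = 1..t. g1 \<tau> - r 1 \<tau>) - (\<Sum>\<tau> = 1..t. d2 \<tau>)"
    and "storage_level (r 1) t + storage_level (r 2) t
           = (\<Sum>\<tau> = 1..t. g1 \<tau>) - (\<Sum>\<tau> = 1..t. d2 \<tau>)"
    by (simp_all add: storage_level_def sum_subtractf)
qed

lemma feasible_point_level_bounds:
  assumes "feasible_point T d2 gmax f12 h g1 r b" "t \<le> T" "k \<in> {1, 2}"
  shows "0 \<le> storage_level (r k) t" "storage_level (r k) t \<le> b k"
proof -
  have "0 \<le> storage_level (r k) t \<and> storage_level (r k) t \<le> b k"
  proof (cases "t = 0")
    case True
    then show ?thesis using assms unfolding feasible_point_def storage_level_def by auto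
  next
    case False
    then have "t \<in> {1..T}" using assms by simp
    then show ?thesis using assms(1,3) unfolding feasible_point_def by blast
  qed
  then show "0 \<le> storage_level (r k) t" "storage_level (r k) t \<le> b k" by auto
qed

lemma feasible_point_demand_le_generation:
  assumes "feasible_point T d2 gmax f12 h g1 r b" "t \<le> T"
  shows "(\<Sum>\<tau> = 1..t. d2 \<tau>) \<le> (\<Sum>\<tau> = 1..t. g1 \<tau>)"
  using feasible_point_levels(2)[OF assms] feasible_point_level_bounds(1)[OF assms, of 1]
    feasible_point_level_bounds(1)[OF assms, of 2] by simp

lemma feasible_point_generation_eq_demand:
  assumes "feasible_point T d2 gmax f12 h g1 r b"
  shows "(\<Sum>\<tau> = 1..T. g1 \<tau>) = (\<Sum>\<tau> = 1..T. d2 \<tau>)"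
  using feasible_point_levels(2)[OF assms order_refl] assms
  unfolding feasible_point_def by simp

text \<open>If the generator is the bottleneck, the deficit after \<open>s\<close> must be covered
  by all the storage; if the line is, by the storage at bus 2. Either is within the budget, and
  either is empty at time 0.\<close>

lemma feasible_point_deficit_le_budget:
  assumes fp: "feasible_point T d2 gmax f12 h g1 r b" and st: "s \<le> t" "t \<le> T"
  shows "(\<Sum>\<tau> = s + 1..t. d2 \<tau> - min gmax f12) \<le> h"
    and "(\<Sum>\<tau> = 1..t. d2 \<tau> - min gmax f12) \<le> 0"
proof -
  let ?s = "\<lambda>k. storage_level (r k)"
  have b: "0 \<le> b 1" "0 \<le> b 2" "b 1 + b 2 \<le> h" using fp unfolding feasible_point_def by auto
  have lev: "0 \<le> ?s k u" "?s k u \<le> b k" if "u \<le> T" "k \<in> {1, 2}" for u k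
    using feasible_point_level_bounds[OF fp that] by auto
  have le: "s \<le> T" using st by simp
  have net: "(\<Sum>\<tau> = u + 1..t. g1 \<tau> - d2 \<tau>) = ?s 1 t + ?s 2 t - (?s 1 u + ?s 2 u)"
    "(\<Sum>\<tau> = u + 1..t. (g1 \<tau> - r 1 \<tau>) - d2 \<tau>) = ?s 2 t - ?s 2 u" if "u \<le> t" for u
    using feasible_point_levels[OF fp, of u] feasible_point_levels[OF fp, of t] that st(2)
    by (simp_all only: sum_subtractf[of _ d2] sum_segment[OF that])
  have bounds: "g1 \<tau> \<le> gmax" "g1 \<tau> - r 1 \<tau> \<le> f12" if "\<tau> \<in> {1..T}" for \<tau>
    using fp that unfolding feasible_point_def abs_le_iff by blast+
  have cap: "(\<Sum>\<tau> = u + 1..t. d2 \<tau> - gmax) \<le> - (\<Sum>\<tau> = u + 1..t. g1 \<tau> - d2 \<tau>)"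
    "(\<Sum>\<tau> = u + 1..t. d2 \<tau> - f12) \<le> - (\<Sum>\<tau> = u + 1..t. (g1 \<tau> - r 1 \<tau>) - d2 \<tau>)" for u
    unfolding sum_negf[symmetric]
  proof -
    have "d2 \<tau> - gmax \<le> - (g1 \<tau> - d2 \<tau>) \<and> d2 \<tau> - f12 \<le> - (g1 \<tau> - r 1 \<tau> - d2 \<tau>)"
      if "\<tau> \<in> {u + 1..t}" for \<tau>
      using bounds[of \<tau>] that st(2) by simp
    then show "(\<Sum>\<tau> = u + 1..t. d2 \<tau> - gmax) \<le> (\<Sum>\<tau> = u + 1..t. - (g1 \<tau> - d2 \<tau>))"
      "(\<Sum>\<tau> = u + 1..t. d2 \<tau> - f12) \<le> (\<Sum>\<tau> = u + 1..t. - (g1 \<tau> - r 1 \<tau> - d2 \<tau>))"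
      by (blast intro: sum_mono)+
  qed
  have "(\<Sum>\<tau> = u + 1..t. d2 \<tau> - gmax) \<le> ?s 1 u + ?s 2 u"
    "(\<Sum>\<tau> = u + 1..t. d2 \<tau> - f12) \<le> ?s 2 u" if "u \<le> t" for u
    using cap[of u] net[OF that] lev[OF st(2), of 1] lev[OF st(2), of 2] by auto
  note * = this[OF st(1)] this[of 0]
  show "(\<Sum>\<tau> = s + 1..t. d2 \<tau> - min gmax f12) \<le> h"
    using *(1,2) lev[OF le, of 1] lev[OF le, of 2] b by (cases "gmax \<le> f12") auto
  show "(\<Sum>\<tau> = 1..t. d2 \<tau> - min gmax f12) \<le> 0"
    using *(3,4) by (cases "gmax \<le> f12") (auto simp: storage_level_def)
qed

section \<open>Sufficient conditions: storage at bus 2 alone\<close>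

text \<open>With no storage at bus 1 the line carries exactly the generation, so both capacities
  become bounds on \<open>g\<close>, and the level at bus 2 is the cumulative surplus.\<close>

lemma feasible_point_bus2:
  assumes "\<And>t. t \<in> {1..T} \<Longrightarrow> 0 \<le> g t \<and> g t \<le> min gmax f12"
    and "\<And>t. t \<le> T \<Longrightarrow>
      0 \<le> (\<Sum>\<tau> = 1..t. g \<tau> - d2 \<tau>) \<and> (\<Sum>\<tau> = 1..t. g \<tau> - d2 \<tau>) \<le> h"
    and "(\<Sum>\<tau> = 1..T. g \<tau> - d2 \<tau>) = 0"
  shows "feasible_point T d2 gmax f12 h g
    (\<lambda>k t. if k = 2 then g t - d2 t else 0) (\<lambda>k. if k = 2 then h else 0)"
proof -
  have "\<bar>g t\<bar> \<le> f12" if "t \<in> {1..T}" for t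
    using assms(1)[OF that] by simp
  then show ?thesis
    using assms(1,2) assms(2)[of 0] assms(3)
    unfolding feasible_point_def storage_level_def by auto
qed

text \<open>Clearing denominators expresses the average condition through the partial sums of
  \<open>d2 - a\<close>, the form shared with \<open>h_min\<close>.\<close>

lemma max_avg_demand_le_iff:
  assumes "1 \<le> T"
  shows "max_avg_demand T d2 \<le> a \<longleftrightarrow> (\<forall>t\<in>{1..T}. (\<Sum>\<tau> = 1..t. d2 \<tau> - a) \<le> 0)"
  unfolding max_avg_demand_def using assms
  by (subst Max_le_iff) (auto simp: sum_subtractf divide_le_eq mult.commute)

lemma finite_setcompr_le_le:
  "finite {f t1 t2 | t1 t2. t1 \<le> t2 \<and> t2 \<le> (T::nat)}"
proof (rule finite_subset)
  show "{f t1 t2 | t1 t2. t1 \<le> t2 \<and> t2 \<le> T} \<subseteq> case_prod f ` ({..T} \<times> {..T})"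
    by force
qed simp

lemma h_min_le_iff:
  "h_min T d2 gmax f12 \<le> h \<longleftrightarrow>
    0 \<le> h \<and> (\<forall>s t. s \<le> t \<and> t \<le> T \<longrightarrow> (\<Sum>\<tau> = s + 1..t. d2 \<tau> - min gmax f12) \<le> h)"
proof -
  have "h_min T d2 gmax f12 \<le> h \<longleftrightarrow>
    (\<forall>s t. s \<le> t \<and> t \<le> T \<longrightarrow> max (\<Sum>\<tau> = s + 1..t. d2 \<tau> - min gmax f12) 0 \<le> h)"
    unfolding h_min_def by (subst Max_le_iff[OF finite_setcompr_le_le]) blast+
  then show ?thesis by auto
qed

text \<open>The storage at bus 2 follows the lowest level \<open>S t\<close> from which the remaining demand can be
  served at rate at most \<open>a\<close>. It satisfies \<open>S (t - 1) = max 0 (d2 t - a + S t)\<close>, so the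
  corresponding generation is \<open>min a (d2 t + S t)\<close>.\<close>

lemma feasible_if_h_min_le:
  assumes T: "1 \<le> T" and nonneg: "0 \<le> gmax" "0 \<le> f12" and d: "\<forall>t\<in>{1..T}. 0 \<le> d2 t"
    and avg: "max_avg_demand T d2 \<le> min gmax f12" and h: "h_min T d2 gmax f12 \<le> h"
  shows "feasible T d2 gmax f12 h"
proof -
  define a where "a = min gmax f12"
  define E where "E t = (\<Sum>\<tau> = 1..t. d2 \<tau> - a)" for t
  \<comment> \<open>The largest excess of demand over \<open>a\<close> accumulated from
    \<open>t\<close> onwards; the empty stretch \<open>v = t\<close> makes it nonnegative.\<close>
  define S where "S t = Max (E ` {t..T}) - E t" for t
  have seg: "(\<Sum>\<tau> = s + 1..t. d2 \<tau> - a) = E t - E s" if "s \<le> t" for s t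
    unfolding E_def by (rule sum_segment[OF that])
  have Smin: "0 \<le> S t" if "t \<le> T" for t
    using that by (simp add: S_def)
  have Sh: "S t \<le> h" if "t \<le> T" for t
  proof -
    have "E v - E t \<le> h" if "v \<in> {t..T}" for v
      using h that seg[of t v] unfolding h_min_le_iff a_def[symmetric]
      by (metis atLeastAtMost_iff)
    then have "Max (E ` {t..T}) \<le> h + E t"
      using that by (subst Max_le_iff) (auto simp: algebra_simps)
    then show ?thesis by (simp add: S_def)
  qed
  have ST: "S T = 0" by (simp add: S_def)
  \<comment> \<open>The average condition enters here: it says that no initial charge is
    required.\<close>
  have S0: "S 0 = 0"
  proof -
    have "E t \<le> 0" if "t \<le> T" for t
      using avg that unfolding max_avg_demand_le_iff[OF T] a_def[symmetric] E_def
      by (cases "t = 0") auto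
    then have "Max (E ` {0..T}) \<le> 0" by (subst Max_le_iff) auto
    moreover have "E 0 = 0" by (simp add: E_def)
    ultimately show ?thesis
      using Smin[of 0] unfolding S_def by linarith
  qed
  \<comment> \<open>Split off the first element of the range of the maximum.\<close>
  have rec: "S t = max 0 (d2 (Suc t) - a + S (Suc t))" if "t < T" for t
  proof -
    have "{t..T} = insert t {Suc t..T}" using that by auto
    then have "Max (E ` {t..T}) = max (E t) (Max (E ` {Suc t..T}))" using that by simp
    moreover have "E (Suc t) = E t + (d2 (Suc t) - a)" by (simp add: E_def)
    ultimately show ?thesis unfolding S_def by auto
  qed
  define g where "g t = min a (d2 t + S t)" for t
  have g: "g (Suc t) - d2 (Suc t) = S (Suc t) - S t" if "t < T" for t
    using rec[OF that] unfolding g_def by auto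
  have sum: "(\<Sum>\<tau> = 1..t. g \<tau> - d2 \<tau>) = S t" if "t \<le> T" for t
    using that by (induction t) (simp_all add: S0 g)
  have "0 \<le> g t \<and> g t \<le> min gmax f12" if "t \<in> {1..T}" for t
    using that d Smin[of t] nonneg unfolding g_def a_def by auto
  then have "feasible_point T d2 gmax f12 h g
    (\<lambda>k t. if k = 2 then g t - d2 t else 0) (\<lambda>k. if k = 2 then h else 0)"
    by (rule feasible_point_bus2) (use sum Smin Sh ST in auto)
  then show ?thesis unfolding feasible_def by blast
qed

lemma feasible_iff:
  assumes "1 \<le> T" "0 \<le> gmax" "0 \<le> f12" "\<forall>t\<in>{1..T}. 0 \<le> d2 t"
    and "max_avg_demand T d2 \<le> min gmax f12"
  shows "feasible T d2 gmax f12 h \<longleftrightarrow> h_min T d2 gmax f12 \<le> h"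
proof
  assume "feasible T d2 gmax f12 h"
  then obtain g1 r b where fp: "feasible_point T d2 gmax f12 h g1 r b"
    unfolding feasible_def by blast
  moreover have "0 \<le> h" using fp unfolding feasible_point_def by auto
  ultimately show "h_min T d2 gmax f12 \<le> h"
    unfolding h_min_le_iff using feasible_point_deficit_le_budget(1) by blast
qed (rule feasible_if_h_min_le[OF assms])

lemma infeasible:
  assumes "1 \<le> T" "min gmax f12 < max_avg_demand T d2"
  shows "\<not> feasible T d2 gmax f12 h"
proof
  assume "feasible T d2 gmax f12 h"
  then obtain g1 r b where "feasible_point T d2 gmax f12 h g1 r b"
    unfolding feasible_def by blast
  from feasible_point_deficit_le_budget(2)[OF this order_refl]
  have "max_avg_demand T d2 \<le> min gmax f12"
    unfolding max_avg_demand_le_iff[OF assms(1)] by (meson atLeastAtMost_iff)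
  then show False using assms(2) by linarith
qed

section \<open>Monotonicity and convexity of the optimal value\<close>

lemma feasible_point_mono:
  assumes "feasible_point T d2 gmax f12 h g1 r b" "h \<le> h'"
  shows "feasible_point T d2 gmax f12 h' g1 r b"
  using assms unfolding feasible_point_def by auto

text \<open>Apart from the line limit, which is convex, every constraint is affine in the variables
  and the budget jointly.\<close>

lemma feasible_point_convex:
  assumes p: "feasible_point T d2 gmax f12 h g r b"
    and p': "feasible_point T d2 gmax f12 h' g' r' b'"
    and u: "0 \<le> u" "0 \<le> v" "u + v = 1"
  shows "feasible_point T d2 gmax f12 (u * h + v * h') (\<lambda>t. u * g t + v * g' t)
    (\<lambda>k t. u * r k t + v * r' k t) (\<lambda>k. u * b k + v * b' k)"
proof -
  have lev: "storage_level (\<lambda>t. u * r k t + v * r' k t) t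
      = u * storage_level (r k) t + v * storage_level (r' k) t" for k t
    by (simp add: storage_level_def sum.distrib sum_distrib_left)
  have mid: "u * x + v * y \<le> z" if "x \<le> z" "y \<le> z" for x y z :: real
    using convex_bound_le[OF that u] .
  have v: "v = 1 - u" using u by simp
  \<comment> \<open>The demand \<open>z\<close> is common to both points and is reproduced because
    \<open>u + v = 1\<close>.\<close>
  have bal: "(u * x + v * x') - (u * y + v * y') = z + (u * w + v * w')"
    if "x - y = z + w" "x' - y' = z + w'" for x x' y y' z w w'
  proof -
    have "(u * x + v * x') - (u * y + v * y') = u * (x - y) + v * (x' - y')"
      by (simp add: algebra_simps)
    also have "\<dots> = (u + v) * z + (u * w + v * w')"
      unfolding that by (simp add: algebra_simps)
    finally show ?thesis using u by simp
  qed
  have abs: "\<bar>(u * x + v * x') - (u * y + v * y')\<bar> \<le> z"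
    if "\<bar>x - y\<bar> \<le> z" "\<bar>x' - y'\<bar> \<le> z" for x x' y y' z
  proof -
    have "(u * x + v * x') - (u * y + v * y') = u * (x - y) + v * (x' - y')"
      by (simp add: algebra_simps)
    also have "\<bar>\<dots>\<bar> \<le> u * \<bar>x - y\<bar> + v * \<bar>x' - y'\<bar>"
      using u abs_triangle_ineq[of "u * (x - y)" "v * (x' - y')"] by (simp add: abs_mult)
    also have "\<dots> \<le> z" by (rule mid[OF that])
    finally show ?thesis .
  qed
  have bud: "(u * b 1 + v * b' 1) + (u * b 2 + v * b' 2) \<le> u * h + v * h'"
  proof -
    have "u * (b 1 + b 2) + v * (b' 1 + b' 2) \<le> u * h + v * h'"
      using p p' u by (intro add_mono mult_left_mono) (auto simp: feasible_point_def)
    then show ?thesis by (simp add: algebra_simps)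
  qed
  show ?thesis
    unfolding feasible_point_def lev
  proof (intro conjI ballI)
    fix t assume t: "t \<in> {1..T}"
    note P = p[unfolded feasible_point_def] p'[unfolded feasible_point_def]
    show "0 \<le> u * g t + v * g' t" using P t u by auto
    show "u * g t + v * g' t \<le> gmax" using P t by (intro mid) auto
    show "u * g t + v * g' t - (u * r 1 t + v * r' 1 t) = d2 t + (u * r 2 t + v * r' 2 t)"
      using P t by (intro bal) auto
    show "\<bar>u * g t + v * g' t - (u * r 1 t + v * r' 1 t)\<bar> \<le> f12"
      using P t by (intro abs) blast+
    fix k :: nat assume k: "k \<in> {1, 2}"
    show "0 \<le> u * storage_level (r k) t + v * storage_level (r' k) t"
      using P t k u by auto
    show "u * storage_level (r k) t + v * storage_level (r' k) t \<le> u * b k + v * b' k"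
      using P t k u by (intro add_mono mult_left_mono) blast+
  next
    fix k :: nat assume k: "k \<in> {1, 2}"
    show "u * storage_level (r k) T + v * storage_level (r' k) T = 0" "0 \<le> u * b k + v * b' k"
      using p p' k u unfolding feasible_point_def by auto
  qed (rule bud)
qed

text \<open>Nonnegative costs bound the set of attainable costs below by 0, which makes its
  \<open>Inf\<close> a genuine lower bound.\<close>

lemma opt_value_le:
  assumes "\<forall>x\<ge>0. c1 x \<ge> 0" "feasible_point T d2 gmax f12 h g1 r b"
  shows "opt_value T d2 c1 gmax f12 h \<le> (\<Sum>t = 1..T. c1 (g1 t))"
  unfolding opt_value_def
proof (rule cInf_lower)
  show "bdd_below {(\<Sum>t = 1..T. c1 (g1 t)) | g1 r b. feasible_point T d2 gmax f12 h g1 r b}"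
    using assms(1) by (intro bdd_belowI[of _ 0]) (auto simp: feasible_point_def intro!: sum_nonneg)
qed (use assms(2) in blast)

lemma opt_value_greatest:
  assumes "feasible T d2 gmax f12 h"
    and "\<And>g1 r b. feasible_point T d2 gmax f12 h g1 r b \<Longrightarrow> x \<le> (\<Sum>t = 1..T. c1 (g1 t))"
  shows "x \<le> opt_value T d2 c1 gmax f12 h"
  unfolding opt_value_def
  by (rule cInf_greatest) (use assms in \<open>auto simp: feasible_def\<close>)

lemma opt_value_antimono:
  assumes "\<forall>x\<ge>0. c1 x \<ge> 0" "\<And>h. h \<in> H \<Longrightarrow> feasible T d2 gmax f12 h"
  shows "antimono_on H (opt_value T d2 c1 gmax f12)"
proof (rule monotone_onI)
  fix h h' assume h: "h \<in> H" "h \<le> h'"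
  show "opt_value T d2 c1 gmax f12 h \<ge> opt_value T d2 c1 gmax f12 h'"
    by (rule opt_value_greatest[OF assms(2)[OF h(1)]])
      (rule opt_value_le[OF assms(1) feasible_point_mono[OF _ h(2)]])
qed

lemma opt_value_convex:
  assumes nonneg: "\<forall>x\<ge>0. c1 x \<ge> 0" and c: "convex_on {0..} c1"
    and H: "convex H" "\<And>h. h \<in> H \<Longrightarrow> feasible T d2 gmax f12 h"
  shows "convex_on H (opt_value T d2 c1 gmax f12)"
proof (rule convex_onI)
  let ?p = "opt_value T d2 c1 gmax f12"
  fix u h h' :: real
  assume u: "0 < u" "u < 1" and h: "h \<in> H" "h' \<in> H"
  define v where "v = 1 - u"
  have v: "0 < v" "v + u = 1" using u by (auto simp: v_def)
  have *: "?p (v * h + u * h') \<le> v * (\<Sum>t = 1..T. c1 (g t)) + u * (\<Sum>t = 1..T. c1 (g' t))"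
    if p: "feasible_point T d2 gmax f12 h g r b" "feasible_point T d2 gmax f12 h' g' r' b'"
    for g r b g' r' b'
  proof -
    have "?p (v * h + u * h') \<le> (\<Sum>t = 1..T. c1 (v * g t + u * g' t))"
      using feasible_point_convex[OF p, of v u] u v by (intro opt_value_le[OF nonneg]) auto
    also have "\<dots> \<le> (\<Sum>t = 1..T. v * c1 (g t) + u * c1 (g' t))"
    proof (rule sum_mono)
      fix t assume "t \<in> {1..T}"
      then have "0 \<le> g t" "0 \<le> g' t" using p unfolding feasible_point_def by auto
      then show "c1 (v * g t + u * g' t) \<le> v * c1 (g t) + u * c1 (g' t)"
        using c u v unfolding convex_on_def by auto
    qed
    finally show ?thesis by (simp add: sum.distrib sum_distrib_left)
  qed
  \<comment> \<open>Attainment of the infima is not assumed. Isolate one cost at a time in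
    \<open>*\<close> and pass to the infimum, first over the points for \<open>h\<close>, then over
    those for \<open>h'\<close>.\<close>
  have "(?p (v * h + u * h') - u * (\<Sum>t = 1..T. c1 (g' t))) / v \<le> ?p h"
    if "feasible_point T d2 gmax f12 h' g' r' b'" for g' r' b'
    using *[OF _ that] v
    by (intro opt_value_greatest[OF H(2)[OF h(1)]]) (auto simp: divide_le_eq algebra_simps)
  then have "(?p (v * h + u * h') - v * ?p h) / u \<le> ?p h'"
    using u v
    by (intro opt_value_greatest[OF H(2)[OF h(2)]]) (auto simp: divide_le_eq algebra_simps)
  then show "?p ((1 - u) *\<^sub>R h + u *\<^sub>R h') \<le> (1 - u) * ?p h + u * ?p h'"
    using u v by (simp add: v_def divide_le_eq algebra_simps)
qed (rule H(1))

section \<open>The concave majorant of cumulative demand\<close>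

definition seg_avg :: "(nat \<Rightarrow> real) \<Rightarrow> (nat \<Rightarrow> nat) \<Rightarrow> nat \<Rightarrow> real" where
  "seg_avg d2 tau m =
     (\<Sum>\<tau> = tau (m-1) + 1..tau m. d2 \<tau>) / (real (tau m) - real (tau (m-1)))"

text \<open>For \<open>t\<close> in \<open>{1..T}\<close> the \<open>LEAST\<close> picks the segment
  containing \<open>t\<close>. It never exceeds \<open>M\<close>, so the uncontrolled values of
  \<open>tau\<close> beyond \<open>M\<close> are not reached.\<close>

definition avg_profile :: "(nat \<Rightarrow> real) \<Rightarrow> (nat \<Rightarrow> nat) \<Rightarrow> nat \<Rightarrow> real" where
  "avg_profile d2 tau t = seg_avg d2 tau (LEAST m. t \<le> tau m)"

context
  fixes T :: nat and d2 :: "nat \<Rightarrow> real" and tau :: "nat \<Rightarrow> nat" and M :: nat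
  assumes tau: "tau_sequence T d2 tau M"
begin

lemma tau_0: "tau 0 = 0" and tau_M: "tau M = T"
  using tau by (simp_all add: tau_sequence_def)

lemma tau_Suc:
  assumes "m < M"
  shows "tau m < tau (Suc m)" "tau (Suc m) \<le> T"
  using tau assms unfolding tau_sequence_def is_arg_max_def
  by (force dest: bspec[of _ _ "Suc m"])+

lemma tau_mono:
  assumes "i \<le> j" "j \<le> M"
  shows "tau i \<le> tau j"
  using assms
proof (induction j rule: dec_induct)
  case (step n)
  then show ?case using tau_Suc(1)[of n] by simp
qed simp

lemma seg_avg_sum:
  assumes "m < M"
  shows "(\<Sum>\<tau> = 1..tau (Suc m). d2 \<tau>) - (\<Sum>\<tau> = 1..tau m. d2 \<tau>)
    = seg_avg d2 tau (Suc m) * (real (tau (Suc m)) - real (tau m))"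
  using tau_Suc(1)[OF assms] sum_segment[of "tau m" "tau (Suc m)" d2]
  by (simp add: seg_avg_def)

text \<open>Maximality of the average with its denominator cleared: from \<open>tau m\<close> on,
  cumulative demand stays below the line through that breakpoint along the next segment. This form
  includes \<open>t = tau m\<close>.\<close>

lemma seg_avg_max:
  assumes "m < M" "tau m \<le> t" "t \<le> T"
  shows "(\<Sum>\<tau> = 1..t. d2 \<tau>) - (\<Sum>\<tau> = 1..tau m. d2 \<tau>)
    \<le> seg_avg d2 tau (Suc m) * (real t - real (tau m))"
proof (cases "t = tau m")
  case False
  then have t: "tau m + 1 \<le> t" using assms by simp
  have "is_arg_max (\<lambda>t. (\<Sum>\<tau> = tau m + 1..t. d2 \<tau>) / (real t - real (tau m)))
      (\<lambda>t. tau m + 1 \<le> t \<and> t \<le> T) (tau (Suc m))"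
    using tau assms(1) unfolding tau_sequence_def by (auto dest: bspec[of _ _ "Suc m"])
  then have "(\<Sum>\<tau> = tau m + 1..t. d2 \<tau>) / (real t - real (tau m)) \<le> seg_avg d2 tau (Suc m)"
    using t assms(3) unfolding is_arg_max_def seg_avg_def by (auto simp: not_less)
  then show ?thesis
    using t sum_segment[OF assms(2), of d2] by (simp add: divide_le_eq)
qed simp

text \<open>Otherwise running on to \<open>tau (Suc (Suc m))\<close> would give a larger average
  from \<open>tau m\<close> than the maximizer \<open>tau (Suc m)\<close>.\<close>

lemma seg_avg_antimono:
  assumes "Suc m < M"
  shows "seg_avg d2 tau (Suc (Suc m)) \<le> seg_avg d2 tau (Suc m)"
proof -
  have m: "m < M" using assms by simp
  have lt: "tau (Suc m) < tau (Suc (Suc m))" using tau_Suc[OF assms] by simp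
  have "(\<Sum>\<tau> = 1..tau (Suc (Suc m)). d2 \<tau>) - (\<Sum>\<tau> = 1..tau m. d2 \<tau>)
      \<le> seg_avg d2 tau (Suc m) * (real (tau (Suc (Suc m))) - real (tau m))"
    using tau_Suc[OF assms] tau_Suc[OF m] by (intro seg_avg_max[OF m]) auto
  then have "seg_avg d2 tau (Suc (Suc m)) * (real (tau (Suc (Suc m))) - real (tau (Suc m)))
      \<le> seg_avg d2 tau (Suc m) * (real (tau (Suc (Suc m))) - real (tau (Suc m)))"
    using seg_avg_sum[OF assms] seg_avg_sum[OF m] by (simp add: algebra_simps)
  then show ?thesis using lt by simp
qed

text \<open>The first segment starts at 0, so its average is one of those in the maximum; later
  averages are no larger.\<close>

lemma seg_avg_le_max_avg_demand:
  assumes "m < M"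
  shows "seg_avg d2 tau (Suc m) \<le> max_avg_demand T d2"
  using assms
proof (induction m)
  case 0
  have "seg_avg d2 tau (Suc 0) = (\<Sum>\<tau> = 1..tau (Suc 0). d2 \<tau>) / real (tau (Suc 0))"
    by (simp add: seg_avg_def tau_0)
  then show ?case
    using tau_Suc[OF 0] unfolding max_avg_demand_def by (auto intro!: Max_ge)
next
  case (Suc m)
  then show ?case using seg_avg_antimono[of m] by simp
qed

lemma seg_avg_nonneg:
  assumes "\<forall>t\<in>{1..T}. 0 \<le> d2 t" "m < M"
  shows "0 \<le> seg_avg d2 tau (Suc m)"
  using assms(1) tau_Suc[OF assms(2)] unfolding seg_avg_def
  by (auto intro!: divide_nonneg_nonneg sum_nonneg)

text \<open>The left side is the gap between the majorant and cumulative demand, the quantity that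
  \<open>u_seg\<close> maximizes.\<close>

lemma seg_excess_le_h_sat:
  assumes "m < M" "tau m < t" "t \<le> tau (Suc m)"
  shows "seg_avg d2 tau (Suc m) * (real t - real (tau m))
      - ((\<Sum>\<tau> = 1..t. d2 \<tau>) - (\<Sum>\<tau> = 1..tau m. d2 \<tau>)) \<le> h_sat d2 tau M"
proof -
  have "seg_avg d2 tau (Suc m) * (real t - real (tau m))
      - ((\<Sum>\<tau> = 1..t. d2 \<tau>) - (\<Sum>\<tau> = 1..tau m. d2 \<tau>)) \<le> u_seg d2 tau (Suc m)"
    using assms sum_segment[of "tau m" t d2] unfolding u_seg_def seg_avg_def
    by (intro Max_ge) (auto intro!: image_eqI[of _ _ t])
  also have "\<dots> \<le> h_sat d2 tau M"
    using assms unfolding h_sat_def by (intro Max_ge) auto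
  finally show ?thesis .
qed

lemma avg_profile_eq:
  assumes "m < M" "tau m < t" "t \<le> tau (Suc m)"
  shows "avg_profile d2 tau t = seg_avg d2 tau (Suc m)"
proof -
  have "(LEAST m. t \<le> tau m) = Suc m"
  proof (rule Least_equality)
    fix j assume j: "t \<le> tau j"
    show "Suc m \<le> j"
    proof (rule ccontr)
      assume "\<not> Suc m \<le> j"
      then have "tau j \<le> tau m" using assms(1) by (intro tau_mono) auto
      then show False using j assms(2) by simp
    qed
  qed (rule assms(3))
  then show ?thesis by (simp add: avg_profile_def)
qed

lemma tau_segment_cases:
  assumes "t \<in> {1..T}"
  obtains m where "m < M" "tau m < t" "t \<le> tau (Suc m)"
proof -
  define n where "n = (LEAST m. t \<le> tau m)"
  have le: "t \<le> tau M" using assms tau_M by simp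
  have n: "t \<le> tau n" unfolding n_def by (rule LeastI[of _ M]) (rule le)
  have "n \<le> M" unfolding n_def using le by (rule Least_le)
  moreover obtain m where m: "n = Suc m"
    using n assms tau_0 by (cases n) auto
  moreover have "\<not> t \<le> tau m" using not_less_Least[of m "\<lambda>m. t \<le> tau m"] m n_def by simp
  ultimately show ?thesis using that[of m] n by simp
qed

text \<open>Identifies the cumulative profile with the majorant: it meets cumulative demand at the
  breakpoints and is linear in between.\<close>

lemma sum_avg_profile_tau:
  assumes "m \<le> M"
  shows "(\<Sum>\<tau> = 1..tau m. avg_profile d2 tau \<tau>) = (\<Sum>\<tau> = 1..tau m. d2 \<tau>)"
    and "\<And>t. m < M \<Longrightarrow> tau m \<le> t \<Longrightarrow> t \<le> tau (Suc m) \<Longrightarrow>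
      (\<Sum>\<tau> = 1..t. avg_profile d2 tau \<tau>)
        = (\<Sum>\<tau> = 1..tau m. d2 \<tau>) + seg_avg d2 tau (Suc m) * (real t - real (tau m))"
proof -
  have seg: "(\<Sum>\<tau> = 1..t. avg_profile d2 tau \<tau>)
      = (\<Sum>\<tau> = 1..tau m. avg_profile d2 tau \<tau>) + seg_avg d2 tau (Suc m) * (real t - real (tau m))"
    if "m < M" "tau m \<le> t" "t \<le> tau (Suc m)" for m t
  proof -
    have "(\<Sum>\<tau> = tau m + 1..t. avg_profile d2 tau \<tau>)
        = (\<Sum>\<tau> = tau m + 1..t. seg_avg d2 tau (Suc m))"
      using that by (intro sum.cong) (auto intro!: avg_profile_eq)
    also have "\<dots> = seg_avg d2 tau (Suc m) * (real t - real (tau m))"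
      using that(2) by (simp add: of_nat_diff)
    finally show ?thesis using sum_segment[OF that(2), of "avg_profile d2 tau"] by linarith
  qed
  show *: "(\<Sum>\<tau> = 1..tau m. avg_profile d2 tau \<tau>) = (\<Sum>\<tau> = 1..tau m. d2 \<tau>)"
    using assms
  proof (induction m)
    case (Suc m)
    then have m: "m < M" by simp
    with Suc.IH have "(\<Sum>\<tau> = 1..tau m. avg_profile d2 tau \<tau>) = (\<Sum>\<tau> = 1..tau m. d2 \<tau>)"
      by simp
    with seg[OF m less_imp_le[OF tau_Suc(1)[OF m]] order_refl] seg_avg_sum[OF m]
    show ?case by linarith
  qed (simp add: tau_0)
  show "\<And>t. m < M \<Longrightarrow> tau m \<le> t \<Longrightarrow> t \<le> tau (Suc m) \<Longrightarrow>
      (\<Sum>\<tau> = 1..t. avg_profile d2 tau \<tau>)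
        = (\<Sum>\<tau> = 1..tau m. d2 \<tau>) + seg_avg d2 tau (Suc m) * (real t - real (tau m))"
    unfolding *[symmetric] by (rule seg)
qed

section \<open>The average profile is feasible and cheapest\<close>

text \<open>The level at bus 2 is the gap between majorant and cumulative demand: nonnegative by
  \<open>seg_avg_max\<close>, at most \<open>h_sat\<close> by
  \<open>seg_excess_le_h_sat\<close>.\<close>

lemma avg_profile_feasible:
  assumes T: "1 \<le> T" and d: "\<forall>t\<in>{1..T}. 0 \<le> d2 t"
    and avg: "max_avg_demand T d2 \<le> min gmax f12" and h: "h_sat d2 tau M \<le> h"
  shows "\<exists>r b. feasible_point T d2 gmax f12 h (avg_profile d2 tau) r b"
proof -
  let ?s = "\<lambda>t. \<Sum>\<tau> = 1..t. avg_profile d2 tau \<tau> - d2 \<tau>"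
  have lev: "0 \<le> ?s t \<and> ?s t \<le> h" if t: "t \<in> {1..T}" for t
  proof -
    obtain m where m: "m < M" "tau m < t" "t \<le> tau (Suc m)" by (rule tau_segment_cases[OF t])
    then show ?thesis
      using seg_excess_le_h_sat[OF m] seg_avg_max[of m t] t h
        sum_avg_profile_tau(2)[of m t] by (simp add: sum_subtractf)
  qed
  have gen: "0 \<le> avg_profile d2 tau t \<and> avg_profile d2 tau t \<le> min gmax f12"
    if t: "t \<in> {1..T}" for t
  proof -
    obtain m where m: "m < M" "tau m < t" "t \<le> tau (Suc m)" by (rule tau_segment_cases[OF t])
    then show ?thesis
      using seg_avg_nonneg[OF d m(1)] seg_avg_le_max_avg_demand[OF m(1)] avg
      by (simp add: avg_profile_eq)
  qed
  have "0 \<le> h" using lev[of T] T by simp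
  then have "0 \<le> ?s t \<and> ?s t \<le> h" if "t \<le> T" for t
    using lev[of t] that by (cases "t = 0") auto
  moreover have "?s T = 0"
    using sum_avg_profile_tau(1)[OF order_refl] by (simp add: sum_subtractf tau_M)
  ultimately show ?thesis
    using feasible_point_bus2[where g = "avg_profile d2 tau", OF gen] by blast
qed

text \<open>Abel summation segment by segment: the subgradients \<open>q\<close> at the segment averages decrease
  with \<open>m\<close>, while the accumulated surplus multiplying them stays nonnegative.\<close>

lemma avg_profile_cost_le_prefix:
  assumes d: "\<forall>t\<in>{1..T}. 0 \<le> d2 t" and g: "\<forall>t\<in>{1..T}. 0 \<le> g t"
    and surplus: "\<And>t. t \<le> T \<Longrightarrow> (\<Sum>\<tau> = 1..t. d2 \<tau>) \<le> (\<Sum>\<tau> = 1..t. g \<tau>)"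
    and q: "\<And>x y. 0 \<le> x \<Longrightarrow> 0 \<le> y \<Longrightarrow> c x + q x * (y - x) \<le> c y"
    and q_mono: "\<And>x y. 0 \<le> x \<Longrightarrow> x \<le> y \<Longrightarrow> q x \<le> q y"
    and m: "m \<le> M"
  shows "(\<Sum>\<tau> = 1..tau m. c (avg_profile d2 tau \<tau>))
      + q (seg_avg d2 tau m) * ((\<Sum>\<tau> = 1..tau m. g \<tau>) - (\<Sum>\<tau> = 1..tau m. d2 \<tau>))
    \<le> (\<Sum>\<tau> = 1..tau m. c (g \<tau>))"
  using m
proof (induction m)
  \<comment> \<open>All sums are empty, so the subgradient at the degenerate
    \<open>seg_avg d2 tau 0\<close> is multiplied by zero.\<close>
  case 0
  then show ?case by (simp add: tau_0)
next
  case (Suc m)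
  then have m: "m < M" by simp
  let ?a = "seg_avg d2 tau"
  let ?x = "\<lambda>m. (\<Sum>\<tau> = 1..tau m. g \<tau>) - (\<Sum>\<tau> = 1..tau m. d2 \<tau>)"
  have lt: "tau m \<le> tau (Suc m)" "tau (Suc m) \<le> T" using tau_Suc[OF m] by auto
  have a: "0 \<le> ?a (Suc m)" by (rule seg_avg_nonneg[OF d m])
  \<comment> \<open>Within one segment the subgradient is constant, so the linear terms add up to it
    times the increment of the surplus \<open>?x\<close>.\<close>
  have "(\<Sum>\<tau> = tau m + 1..tau (Suc m). c (?a (Suc m)) + q (?a (Suc m)) * (g \<tau> - ?a (Suc m)))
      \<le> (\<Sum>\<tau> = tau m + 1..tau (Suc m). c (g \<tau>))"
    using g lt a by (intro sum_mono q) auto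
  moreover have "(\<Sum>\<tau> = tau m + 1..tau (Suc m). c (avg_profile d2 tau \<tau>))
      = (\<Sum>\<tau> = tau m + 1..tau (Suc m). c (?a (Suc m)))"
    by (intro sum.cong) (auto simp: avg_profile_eq[OF m])
  moreover have "(\<Sum>\<tau> = tau m + 1..tau (Suc m). q (?a (Suc m)) * (g \<tau> - ?a (Suc m)))
      = q (?a (Suc m)) * (?x (Suc m) - ?x m)"
  proof -
    have "(\<Sum>\<tau> = tau m + 1..tau (Suc m). g \<tau> - ?a (Suc m)) = ?x (Suc m) - ?x m"
      using seg_avg_sum[OF m] lt sum_segment[OF lt(1), of g]
      by (simp add: sum_subtractf of_nat_diff algebra_simps)
    then show ?thesis by (simp only: sum_distrib_left[symmetric])
  qed
  ultimately have seg: "(\<Sum>\<tau> = 1..tau (Suc m). c (avg_profile d2 tau \<tau>))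
        - (\<Sum>\<tau> = 1..tau m. c (avg_profile d2 tau \<tau>)) + q (?a (Suc m)) * (?x (Suc m) - ?x m)
      \<le> (\<Sum>\<tau> = 1..tau (Suc m). c (g \<tau>)) - (\<Sum>\<tau> = 1..tau m. c (g \<tau>))"
    unfolding sum_segment[OF lt(1)] sum.distrib by linarith
  \<comment> \<open>Links consecutive segments: the accumulated surplus is re-weighted from the old
    subgradient to the new, smaller one.\<close>
  have "q (?a (Suc m)) * ?x m \<le> q (?a m) * ?x m"
  proof (cases m)
    case 0
    then show ?thesis by (simp add: tau_0)
  next
    case (Suc n)
    then have "q (?a (Suc m)) \<le> q (?a m)"
      using a m seg_avg_antimono[of n] by (intro q_mono) auto
    moreover have "0 \<le> ?x m" using surplus[of "tau m"] lt by simp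
    ultimately show ?thesis by (rule mult_right_mono)
  qed
  with seg Suc.IH m show ?case by (simp add: right_diff_distrib)
qed

text \<open>In the prefix bound at \<open>m = M\<close> the surplus term vanishes, because all
  storage is empty at \<open>T\<close>.\<close>

lemma avg_profile_optimal:
  assumes c: "mono_on {0..} c1" "convex_on {0..} c1" and d: "\<forall>t\<in>{1..T}. 0 \<le> d2 t"
    and fp: "feasible_point T d2 gmax f12 h g r b"
  shows "(\<Sum>t = 1..T. c1 (avg_profile d2 tau t)) \<le> (\<Sum>t = 1..T. c1 (g t))"
proof -
  obtain q where q: "\<And>x y. 0 \<le> x \<Longrightarrow> 0 \<le> y \<Longrightarrow> c1 x + q x * (y - x) \<le> c1 y"
    "\<And>x y. 0 \<le> x \<Longrightarrow> x \<le> y \<Longrightarrow> q x \<le> q y"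
    using mono_convex_subgradient[OF c] by metis
  have "\<forall>t\<in>{1..T}. 0 \<le> g t" using fp unfolding feasible_point_def by blast
  from avg_profile_cost_le_prefix[OF d this feasible_point_demand_le_generation[OF fp] q order_refl]
  show ?thesis using feasible_point_generation_eq_demand[OF fp] by (simp add: tau_M)
qed

text \<open>The right side does not mention \<open>h\<close>, which gives constancy; the same
  profile also witnesses feasibility for every such \<open>h\<close>.\<close>

lemma opt_value_saturated:
  assumes T: "1 \<le> T" and d: "\<forall>t\<in>{1..T}. 0 \<le> d2 t"
    and c: "\<forall>x\<ge>0. c1 x \<ge> 0" "mono_on {0..} c1" "convex_on {0..} c1"
    and avg: "max_avg_demand T d2 \<le> min gmax f12" and h: "h_sat d2 tau M \<le> h"
  shows "opt_value T d2 c1 gmax f12 h = (\<Sum>t = 1..T. c1 (avg_profile d2 tau t))"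
proof (rule antisym)
  obtain r b where fp: "feasible_point T d2 gmax f12 h (avg_profile d2 tau) r b"
    using avg_profile_feasible[OF T d avg h] by blast
  show "opt_value T d2 c1 gmax f12 h \<le> (\<Sum>t = 1..T. c1 (avg_profile d2 tau t))"
    by (rule opt_value_le[OF c(1) fp])
  show "(\<Sum>t = 1..T. c1 (avg_profile d2 tau t)) \<le> opt_value T d2 c1 gmax f12 h"
    using fp avg_profile_optimal[OF c(2,3) d]
    by (intro opt_value_greatest) (auto simp: feasible_def)
qed

end

theorem proposition3:
  fixes T :: nat and d2 :: "nat \<Rightarrow> real" and c1 :: "real \<Rightarrow> real" and gmax f12 :: real
  assumes "T \<ge> 1"
    and "gmax \<ge> 0" and "f12 \<ge> 0"
    and "\<forall>t\<in>{1..T}. d2 t \<ge> 0"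
    and "\<forall>x\<ge>0. c1 x \<ge> 0"
    and "mono_on {0..} c1"
    and "strictly_convex_on {0..} c1"
  shows
    "(min gmax f12 < max_avg_demand T d2 \<longrightarrow>
        (\<forall>h\<ge>0. \<not> feasible T d2 gmax f12 h)) \<and>
     (min gmax f12 \<ge> max_avg_demand T d2 \<longrightarrow>
        (\<forall>h\<ge>0. feasible T d2 gmax f12 h \<longleftrightarrow> h \<ge> h_min T d2 gmax f12) \<and>
        convex_on {h_min T d2 gmax f12..} (opt_value T d2 c1 gmax f12) \<and>
        antimono_on {h_min T d2 gmax f12..} (opt_value T d2 c1 gmax f12) \<and>
        (\<forall>tau M. tau_sequence T d2 tau M \<longrightarrow>
           opt_value T d2 c1 gmax f12 constant_on {h_sat d2 tau M..}))"
proof (intro conjI impI)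
  assume "min gmax f12 < max_avg_demand T d2"
  then show "\<forall>h\<ge>0. \<not> feasible T d2 gmax f12 h" using infeasible[OF assms(1)] by blast
next
  assume avg: "max_avg_demand T d2 \<le> min gmax f12"
  note c = strictly_convex_on_imp_convex_on[OF assms(7)]
  have feas: "feasible T d2 gmax f12 h \<longleftrightarrow> h_min T d2 gmax f12 \<le> h" for h
    by (rule feasible_iff[OF assms(1-4) avg])
  then show "\<forall>h\<ge>0. feasible T d2 gmax f12 h \<longleftrightarrow> h_min T d2 gmax f12 \<le> h" by blast
  show "convex_on {h_min T d2 gmax f12..} (opt_value T d2 c1 gmax f12)"
    by (rule opt_value_convex[OF assms(5) c]) (simp_all add: feas)
  show "antimono_on {h_min T d2 gmax f12..} (opt_value T d2 c1 gmax f12)"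
    by (rule opt_value_antimono[OF assms(5)]) (simp add: feas)
  show "\<forall>tau M. tau_sequence T d2 tau M \<longrightarrow>
      opt_value T d2 c1 gmax f12 constant_on {h_sat d2 tau M..}"
    unfolding constant_on_def
    using opt_value_saturated[OF _ assms(1,4,5,6) c avg] by (metis atLeast_iff)
qed

end
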